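(* Let $m,n$ be positive integers with $m<2^n$. Consider the following game. Kronecker holds a list of $m$ vectors $v_1,\ldots,v_m\in\{0,1\}^n$, unknown to Cantor. Cantor may ask queries of the form ``what is bit number $j$ of vector number $i$?'' (for $1\le i\le m$, $1\le j\le n$), which Kronecker answers truthfully; Cantor may choose each query adaptively, depending on the answers to previous queries. Cantor's goal is to output a vector $u\in\{0,1\}^n$ with $u\neq v_i$ for all $1\le i\le m$. Let $g(n,m)$ be the smallest number $q$ such that Cantor has an adaptive strategy that, for every list $v_1,\ldots,v_m$ of Kronecker, asks at most $q$ queries and then outputs such a vector $u$. Then \[ g(n,m)=\begin{cases} m & \text{if } m\le n,\\ 2m-n & \text{if } n<m<2^n.\end{cases} \] *)

theory Defs
  imports Complex_Main "HOL-Library.FuncSet"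
begin

text \<open>The bit 1 is represented by \<open>True\<close>. Vectors in $\{0,1\}^n$ and lists of such vectors are
  extensional functions on \<open>{1..n}\<close> and \<open>{1..m}\<close>, so that HOL equality of elements of
  \<open>bit_vectors n\<close> is equality of vectors.\<close>

definition bit_vectors :: "nat \<Rightarrow> (nat \<Rightarrow> bool) set" where
  "bit_vectors n = {1..n} \<rightarrow>\<^sub>E UNIV"

definition vector_lists :: "nat \<Rightarrow> nat \<Rightarrow> (nat \<Rightarrow> nat \<Rightarrow> bool) set" where
  "vector_lists n m = {1..m} \<rightarrow>\<^sub>E bit_vectors n"

text \<open>An adaptive strategy is a decision tree. \<open>Query i j next\<close> asks for bit \<open>j\<close> of vector \<open>i\<close> and
  continues with \<open>next b\<close> on receiving the answer \<open>b\<close>.\<close>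

datatype strategy =
    Output "nat \<Rightarrow> bool"
  | Query nat nat "bool \<Rightarrow> strategy"

primrec legal :: "nat \<Rightarrow> nat \<Rightarrow> strategy \<Rightarrow> bool" where
  "legal n m (Output u) \<longleftrightarrow> u \<in> bit_vectors n"
| "legal n m (Query i j next) \<longleftrightarrow> i \<in> {1..m} \<and> j \<in> {1..n} \<and> (\<forall>b. legal n m (next b))"

primrec queries :: "strategy \<Rightarrow> (nat \<Rightarrow> nat \<Rightarrow> bool) \<Rightarrow> nat" where
  "queries (Output u) v = 0"
| "queries (Query i j next) v = Suc (queries (next (v i j)) v)"

primrec final_output :: "strategy \<Rightarrow> (nat \<Rightarrow> nat \<Rightarrow> bool) \<Rightarrow> (nat \<Rightarrow> bool)" where
  "final_output (Output u) v = u"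
| "final_output (Query i j next) v = final_output (next (v i j)) v"

definition wins_within :: "nat \<Rightarrow> nat \<Rightarrow> nat \<Rightarrow> strategy \<Rightarrow> bool" where
  "wins_within n m q s \<longleftrightarrow> legal n m s \<and>
     (\<forall>v \<in> vector_lists n m. queries s v \<le> q \<and> (\<forall>i \<in> {1..m}. final_output s v \<noteq> v i))"

definition g :: "nat \<Rightarrow> nat \<Rightarrow> nat" where
  "g n m = (LEAST q. \<exists>s. wins_within n m q s)"

end

theory Submission
  imports Defs
begin

text \<open>Upper bound: for a column \<open>j\<close>, Cantor reads bit \<open>j\<close> of \<open>2k + 1\<close> vectors and commits to the
  minority value, which disposes of \<open>k + 1\<close> of them; the remaining \<open>m - k - 1\<close> vectors are handled
  in the other \<open>n - 1\<close> columns. This trade of \<open>2k + 1\<close> queries for \<open>k + 1\<close> vectors and one column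
  preserves \<open>2m - n\<close>, and \<open>k\<close> can be chosen so that \<open>n \<le> m < 2^n\<close> is preserved as well. For
  \<open>m \<le> n\<close> only \<open>m\<close> of the columns are used.

  Lower bound: Kronecker answers the new queries in each column alternately. If column \<open>j\<close> is
  queried \<open>q\<^sub>j\<close> times, then the choice of \<open>u\<^sub>j\<close> distinguishes \<open>u\<close> from at most \<open>\<lceil>q\<^sub>j / 2\<rceil>\<close>
  vectors, so \<open>m \<le> \<Sum>\<^sub>j \<lceil>q\<^sub>j / 2\<rceil>\<close>, which is at most both \<open>q\<close> and \<open>(q + n) / 2\<close>.\<close>

section \<open>Upper bound\<close>

text \<open>Reading the rows of \<open>T\<close> one after another gives a binary tree whose leaves
  correspond to the possible sets \<open>A\<close> of rows with answer 1, so a continuation can be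
  chosen separately for each \<open>A\<close>. \<open>P\<close> varies in the induction because it
  accumulates the answers already received.\<close>

lemma query_column:
  assumes "finite T" "T \<subseteq> {1..m}" "j \<in> {1..n}"
    and "\<And>A. A \<subseteq> T \<Longrightarrow> \<exists>s. legal n m s \<and>
      (\<forall>v. P v \<and> {i \<in> T. v i j} = A \<longrightarrow> queries s v \<le> c \<and> R v (final_output s v))"
  shows "\<exists>s. legal n m s \<and> (\<forall>v. P v \<longrightarrow> queries s v \<le> card T + c \<and> R v (final_output s v))"
  using assms
proof (induction T arbitrary: P rule: finite_induct)
  case empty
  then show ?case by auto
next
  case (insert i T)
  have "\<exists>s. legal n m s \<and>
      (\<forall>v. P v \<and> v i j = b \<longrightarrow> queries s v \<le> card T + c \<and> R v (final_output s v))" for b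
  proof (rule insert.IH)
    fix A assume A: "A \<subseteq> T"
    define A' where "A' = (if b then insert i A else A)"
    have "A' \<subseteq> insert i T" using A by (auto simp: A'_def)
    from insert.prems(3)[OF this] obtain s where legal: "legal n m s"
      and s: "\<forall>v. P v \<and> {i' \<in> insert i T. v i' j} = A' \<longrightarrow>
        queries s v \<le> c \<and> R v (final_output s v)"
      by (elim exE conjE)
    have "{i' \<in> insert i T. v i' j} = A'" if "v i j = b" "{i' \<in> T. v i' j} = A" for v
      using that by (auto simp: A'_def)
    with legal s show "\<exists>s. legal n m s \<and> (\<forall>v. (P v \<and> v i j = b) \<and> {i \<in> T. v i j} = A \<longrightarrow>
        queries s v \<le> c \<and> R v (final_output s v))"
      by (intro exI[of _ s]) simp
  qed (use insert.prems in auto)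
  then have "\<forall>b. \<exists>s. legal n m s \<and>
      (\<forall>v. P v \<and> v i j = b \<longrightarrow> queries s v \<le> card T + c \<and> R v (final_output s v))"
    by (intro allI)
  from choice[OF this] obtain s where s: "\<forall>b. legal n m (s b) \<and>
      (\<forall>v. P v \<and> v i j = b \<longrightarrow> queries (s b) v \<le> card T + c \<and> R v (final_output (s b) v))"
    by (elim exE)
  show ?case
    using s insert.hyps insert.prems(1,2) by (intro exI[of _ "Query i j s"]) simp
qed

lemma majority_choice:
  fixes p :: "'a \<Rightarrow> bool"
  assumes "finite T" "card T = 2 * k + 1"
  obtains b D where "D \<subseteq> {i \<in> T. p i = b}" "card D = k + 1"
proof -
  have "{i \<in> T. p i = True} \<union> {i \<in> T. p i = False} = T"
    "{i \<in> T. p i = True} \<inter> {i \<in> T. p i = False} = {}"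
    by auto
  then have "card {i \<in> T. p i = True} + card {i \<in> T. p i = False} = 2 * k + 1"
    using assms card_Un_disjoint[of "{i \<in> T. p i = True}" "{i \<in> T. p i = False}"] by auto
  then have "k + 1 \<le> card {i \<in> T. p i = True} \<or> k + 1 \<le> card {i \<in> T. p i = False}"
    by linarith
  then obtain b where "k + 1 \<le> card {i \<in> T. p i = b}" by blast
  then obtain D where "D \<subseteq> {i \<in> T. p i = b}" "card D = k + 1"
    by (rule obtain_subset_with_card_n)
  then show thesis by (rule that)
qed

text \<open>\<open>J\<close> holds the columns still available and \<open>S\<close> the rows still
  to be avoided. Prescribing the bits outside \<open>J\<close> by \<open>w\<close> lets a bit
  committed in a spent column survive in the output of the continuation.\<close>

lemma strategy_exists:
  assumes "finite J" "J \<subseteq> {1..n}" "S \<subseteq> {1..m}" "card J \<le> card S" "card S < 2 ^ card J"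
    and "w \<in> bit_vectors n"
  shows "\<exists>s. legal n m s \<and> (\<forall>v. queries s v \<le> 2 * card S - card J \<and>
      (\<forall>i\<in>S. \<exists>j\<in>J. final_output s v j \<noteq> v i j) \<and> (\<forall>j. j \<notin> J \<longrightarrow> final_output s v j = w j))"
  using assms
proof (induction J arbitrary: S w rule: finite_induct)
  case empty
  then have "S = {}" by (simp add: finite_subset[OF empty.prems(2)])
  then show ?case using empty.prems by (intro exI[of _ "Output w"]) auto
next
  case (insert j J)
  have finS: "finite S" using finite_subset[OF insert.prems(2)] by simp
  \<comment> \<open>The first argument of \<open>min\<close> keeps at least \<open>card J\<close>
    rows for the remaining columns, the second ensures that \<open>2 * k + 1\<close> rows are
    available. If the first is attained, exactly \<open>card J\<close> rows remain; if the second
    is, \<open>card S div 2\<close> remain. Both numbers are below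
    \<open>2 ^ card J\<close>.\<close>
  define k where "k = min (card S - Suc (card J)) ((card S - 1) div 2)"
  have le: "Suc (card J) \<le> card S" and less: "card S < 2 * 2 ^ card J"
    using insert.prems insert.hyps by auto
  have k: "2 * k + 1 \<le> card S" "card J \<le> card S - (k + 1)"
    using le by (auto simp: k_def)
  have "card J < 2 ^ card J" by simp
  then have k_less: "card S - (k + 1) < 2 ^ card J"
    using le less unfolding k_def min_def by (auto split: if_splits)
  obtain T where T: "T \<subseteq> S" "card T = 2 * k + 1" "finite T"
    using obtain_subset_with_card_n[OF k(1)] by metis
  define R where "R = (\<lambda>v u. (\<forall>i\<in>S. \<exists>j'\<in>insert j J. u j' \<noteq> v i j') \<and>
      (\<forall>j'. j' \<notin> insert j J \<longrightarrow> u j' = w j'))"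
  have ex: "\<exists>s. legal n m s \<and> (\<forall>v. True \<longrightarrow>
      queries s v \<le> card T + (2 * (card S - (k + 1)) - card J) \<and> R v (final_output s v))"
  proof (rule query_column[where R = R and j = j])
    fix A assume "A \<subseteq> T"
    obtain b D where D: "D \<subseteq> {i \<in> T. (i \<in> A) = b}" "card D = k + 1"
      using majority_choice[OF T(3,2)] .
    have DS: "D \<subseteq> S" using D T by blast
    have card: "card (S - D) = card S - (k + 1)"
      using D DS finS by (simp add: card_Diff_subset finite_subset)
    \<comment> \<open>The value \<open>b\<close> occurs in column \<open>j\<close> on all of
      \<open>D\<close>, so committing to its negation excludes every row of \<open>D\<close> at
      once.\<close>
    define w' where "w' = w(j := \<not> b)"
    have "w' \<in> bit_vectors n"
      using insert.prems(1,5) by (auto simp: w'_def bit_vectors_def PiE_def extensional_def)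
    then have "\<exists>s. legal n m s \<and> (\<forall>v. queries s v \<le> 2 * card (S - D) - card J \<and>
        (\<forall>i\<in>S - D. \<exists>j\<in>J. final_output s v j \<noteq> v i j) \<and>
        (\<forall>j'. j' \<notin> J \<longrightarrow> final_output s v j' = w' j'))"
      using insert.prems(1,2) k(2) k_less by (intro insert.IH) (auto simp: card)
    then obtain s where legal: "legal n m s"
      and s: "\<forall>v. queries s v \<le> 2 * card (S - D) - card J \<and>
        (\<forall>i\<in>S - D. \<exists>j\<in>J. final_output s v j \<noteq> v i j) \<and>
        (\<forall>j'. j' \<notin> J \<longrightarrow> final_output s v j' = w' j')"
      by (elim exE conjE)
    have "R v (final_output s v)" if "{i \<in> T. v i j} = A" for v
    proof -
      have "final_output s v j = (\<not> b)"
        using s \<open>j \<notin> J\<close> by (simp add: w'_def)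
      then have "final_output s v j \<noteq> v i j" if "i \<in> D" for i
        using that D \<open>{i \<in> T. v i j} = A\<close> by auto
      moreover have "\<exists>j\<in>J. final_output s v j \<noteq> v i j" if "i \<in> S - D" for i
        using that s by blast
      moreover have "final_output s v j' = w j'" if "j' \<notin> insert j J" for j'
        using that s by (simp add: w'_def)
      ultimately show ?thesis unfolding R_def by blast
    qed
    then show "\<exists>s. legal n m s \<and> (\<forall>v. True \<and> {i \<in> T. v i j} = A \<longrightarrow>
        queries s v \<le> 2 * (card S - (k + 1)) - card J \<and> R v (final_output s v))"
      using legal s unfolding card by meson
  qed (use T insert.prems in auto)
  \<comment> \<open>Here (2k + 1) + 2(|S| - k - 1) - |J| = 2|S| - (|J| + 1); by \<open>k\<close> no
    subtraction is truncated.\<close>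
  have bound: "card T + (2 * (card S - (k + 1)) - card J) \<le> 2 * card S - card (insert j J)"
    using T k insert.hyps by auto
  obtain s where "legal n m s" and s: "\<forall>v. True \<longrightarrow>
      queries s v \<le> card T + (2 * (card S - (k + 1)) - card J) \<and> R v (final_output s v)"
    using ex by (elim exE conjE)
  moreover have "queries s v \<le> 2 * card S - card (insert j J)" for v
    using s bound order_trans by blast
  moreover have "R v (final_output s v)" for v
    using s by blast
  ultimately show ?case
    unfolding R_def by (intro exI[of _ s] conjI allI) simp_all
qed

lemma wins_within_upper:
  assumes "m < 2 ^ n"
  shows "\<exists>s. wins_within n m (if m \<le> n then m else 2 * m - n) s"
proof -
  \<comment> \<open>With \<open>r\<close> columns the bound is \<open>2 * m - r\<close>, which
    equals \<open>m\<close> for \<open>r = m\<close>; in that case m < 2^m supplies the size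
    condition.\<close>
  define r where "r = min m n"
  have w: "restrict (\<lambda>_. False) {1..n} \<in> bit_vectors n"
    by (auto simp: bit_vectors_def)
  have "m < 2 ^ r" using assms by (auto simp: r_def min_def)
  then obtain s where legal: "legal n m s" and s: "\<forall>v. queries s v \<le> 2 * m - r \<and>
      (\<forall>i\<in>{1..m}. \<exists>j\<in>{1..r}. final_output s v j \<noteq> v i j) \<and>
      (\<forall>j. j \<notin> {1..r} \<longrightarrow> final_output s v j = restrict (\<lambda>_. False) {1..n} j)"
    using strategy_exists[of "{1..r}" n "{1..m}" m, OF _ _ _ _ _ w] by (auto simp: r_def)
  have "final_output s v \<noteq> v i" if "i \<in> {1..m}" for v i
    using s that by metis
  moreover have "2 * m - r = (if m \<le> n then m else 2 * m - n)"
    by (auto simp: r_def)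
  ultimately show ?thesis
    using legal s unfolding wins_within_def by (intro exI[of _ s]) simp
qed

section \<open>Lower bound\<close>

text \<open>As \<open>b\<close> takes both values, the two answer counts in a column differ by at
  most one. This keeps what alternation guarantees without recording the order of the
  queries.\<close>

definition balanced :: "(nat \<times> nat) set \<Rightarrow> (nat \<Rightarrow> nat \<Rightarrow> bool) \<Rightarrow> bool" where
  "balanced Q f \<longleftrightarrow>
    (\<forall>j b. card {i. (i, j) \<in> Q \<and> f i j = b} \<le> Suc (card {i. (i, j) \<in> Q \<and> f i j \<noteq> b}))"

lemma finite_column: "finite Q \<Longrightarrow> finite {i. (i, j) \<in> Q \<and> P i}"
  by (rule finite_subset[of _ "fst ` Q"]) (force, simp)

lemma balanced_extend:
  assumes "finite Q" "balanced Q f" "(i, j) \<notin> Q"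
  obtains b where "balanced (insert (i, j) Q) (f(i := (f i)(j := b)))"
proof -
  define C where "C = (\<lambda>b. {i'. (i', j) \<in> Q \<and> f i' j = b})"
  \<comment> \<open>The new answer is a value at most as frequent in column \<open>j\<close> as the
    other, so its count exceeds the other by at most one afterwards.\<close>
  define b where "b = (card (C True) \<le> card (C False))"
  define f' where "f' = f(i := (f i)(j := b))"
  have C_b: "card (C b) \<le> card (C (\<not> b))" by (cases "card (C True) \<le> card (C False)") (auto simp: b_def)
  have fin: "finite (C c)" for c
    using finite_column[OF assms(1), of j "\<lambda>i. f i j = c"] by (simp add: C_def)
  have other: "{i'. (i', j') \<in> insert (i, j) Q \<and> f' i' j' = c} = {i'. (i', j') \<in> Q \<and> f i' j' = c}"
    if "j' \<noteq> j" for j' c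
    using that by (auto simp: f'_def)
  have same: "{i'. (i', j) \<in> insert (i, j) Q \<and> f' i' j = c} = (if c = b then insert i (C c) else C c)"
    for c
    using assms(3) by (auto simp: f'_def C_def)
  have "i \<notin> C b" using assms(3) by (auto simp: C_def)
  have flip: "(x \<noteq> c) = (x = (\<not> c))" for x c :: bool by auto
  have old: "card (C c) \<le> Suc (card (C (\<not> c)))" for c
    using assms(2) unfolding balanced_def C_def flip by blast
  have "balanced (insert (i, j) Q) f'"
    unfolding balanced_def
  proof (intro allI)
    fix j' c
    show "card {i'. (i', j') \<in> insert (i, j) Q \<and> f' i' j' = c} \<le>
        Suc (card {i'. (i', j') \<in> insert (i, j) Q \<and> f' i' j' \<noteq> c})"
    proof (cases "j' = j")
      case True
      show ?thesis
        unfolding True flip same using C_b old[of c] fin \<open>i \<notin> C b\<close> by (cases c; cases b) auto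
    next
      case False
      show ?thesis
        unfolding flip other[OF False] using assms(2) unfolding balanced_def flip by blast
    qed
  qed
  then show thesis using that by (simp add: f'_def)
qed

text \<open>\<open>Q\<close> records the positions already answered and \<open>f\<close> their
  answers. The conclusion covers every \<open>v\<close> consistent with the final answers, so
  entries outside \<open>Q'\<close> stay free while the output is fixed.\<close>

lemma adversary:
  assumes "legal n m s" "finite Q" "Q \<subseteq> {1..m} \<times> {1..n}" "balanced Q f"
  shows "\<exists>Q' f' u. Q \<subseteq> Q' \<and> Q' \<subseteq> {1..m} \<times> {1..n} \<and> balanced Q' f' \<and>
    (\<forall>(i, j)\<in>Q. f' i j = f i j) \<and> u \<in> bit_vectors n \<and>
    (\<forall>v. (\<forall>(i, j)\<in>Q'. v i j = f' i j) \<longrightarrow>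
      card Q' \<le> card Q + queries s v \<and> final_output s v = u)"
  using assms
proof (induction s arbitrary: Q f)
  case (Output u)
  then show ?case by (intro exI[of _ Q] exI[of _ f] exI[of _ u]) auto
next
  case (Query i j "next")
  show ?case
  proof (cases "(i, j) \<in> Q")
    case True
    \<comment> \<open>A repeated query receives its old answer. It costs a query without enlarging
      \<open>Q\<close>, which only weakens the required inequality.\<close>
    obtain Q' f' u where *: "Q \<subseteq> Q'" "Q' \<subseteq> {1..m} \<times> {1..n}" "balanced Q' f'"
      "\<forall>(i, j)\<in>Q. f' i j = f i j" "u \<in> bit_vectors n"
      "\<And>v. (\<forall>(i, j)\<in>Q'. v i j = f' i j) \<Longrightarrow>
        card Q' \<le> card Q + queries (next (f i j)) v \<and> final_output (next (f i j)) v = u"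
      using Query.IH[of "next (f i j)" Q f] Query.prems by auto
    have "v i j = f i j" if "\<forall>(i, j)\<in>Q'. v i j = f' i j" for v
      using that *(1,4) True by fastforce
    then show ?thesis
      using * by (intro exI[of _ Q'] exI[of _ f'] exI[of _ u]) (auto simp: le_SucI)
  next
    case False
    obtain b where "balanced (insert (i, j) Q) (f(i := (f i)(j := b)))"
      using balanced_extend[OF Query.prems(2,4) False] .
    moreover define h where "h = f(i := (f i)(j := b))"
    ultimately have "balanced (insert (i, j) Q) h" by simp
    then obtain Q' f' u where *: "insert (i, j) Q \<subseteq> Q'" "Q' \<subseteq> {1..m} \<times> {1..n}" "balanced Q' f'"
      "\<forall>(i', j')\<in>insert (i, j) Q. f' i' j' = h i' j'" "u \<in> bit_vectors n"
      "\<And>v. (\<forall>(i, j)\<in>Q'. v i j = f' i j) \<Longrightarrow>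
        card Q' \<le> card (insert (i, j) Q) + queries (next b) v \<and> final_output (next b) v = u"
      using Query.IH[of "next b" "insert (i, j) Q" h] Query.prems by auto
    have "v i j = b" if "\<forall>(i, j)\<in>Q'. v i j = f' i j" for v
      using that *(1,4) by (auto simp: h_def)
    moreover have "\<forall>(i', j')\<in>Q. f' i' j' = f i' j'"
      using *(4) False by (auto simp: h_def split: if_splits)
    ultimately show ?thesis
      using * False Query.prems(2) by (intro exI[of _ Q'] exI[of _ f'] exI[of _ u]) auto
  qed
qed

lemma wins_within_lower:
  assumes "wins_within n m q s"
  shows "m \<le> q" "2 * m \<le> q + n"
proof -
  have s: "legal n m s" and
    win: "\<And>v. v \<in> vector_lists n m \<Longrightarrow> queries s v \<le> q \<and> (\<forall>i\<in>{1..m}. final_output s v \<noteq> v i)"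
    using assms by (auto simp: wins_within_def)
  have "balanced {} f" for f by (simp add: balanced_def)
  then obtain Q f u where Q: "Q \<subseteq> {1..m} \<times> {1..n}" and bal: "balanced Q f"
    and u: "u \<in> bit_vectors n"
    and f: "\<And>v. (\<forall>(i, j)\<in>Q. v i j = f i j) \<Longrightarrow> card Q \<le> queries s v \<and> final_output s v = u"
    using adversary[OF s, of "{}" "\<lambda>_ _. False"] by auto
  have finQ: "finite Q" using Q by (rule finite_subset) simp
  define v where "v = (\<lambda>i\<in>{1..m}. \<lambda>j\<in>{1..n}. f i j)"
  have v: "v \<in> vector_lists n m"
    by (auto simp: v_def vector_lists_def bit_vectors_def)
  have vf: "\<forall>(i, j)\<in>Q. v i j = f i j"
    using Q by (auto simp: v_def)
  have cardQ: "card Q \<le> q"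
    using f[OF vf] win[OF v] by linarith
  \<comment> \<open>\<open>B j\<close> collects the rows that the answers in column \<open>j\<close>
    show to differ from \<open>u\<close>, and \<open>G j\<close> the answered rows that agree with
    \<open>u\<close> there.\<close>
  define B where "B = (\<lambda>j. {i. (i, j) \<in> Q \<and> f i j \<noteq> u j})"
  define G where "G = (\<lambda>j. {i. (i, j) \<in> Q \<and> f i j = u j})"
  have fin: "finite (B j)" "finite (G j)" for j
    unfolding B_def G_def by (rule finite_column[OF finQ])+
  have "{1..m} \<subseteq> (\<Union>j\<in>{1..n}. B j)"
  proof
    fix i assume i: "i \<in> {1..m}"
    show "i \<in> (\<Union>j\<in>{1..n}. B j)"
    proof (rule ccontr)
      assume no: "i \<notin> (\<Union>j\<in>{1..n}. B j)"
      \<comment> \<open>If no answer separates row \<open>i\<close> from \<open>u\<close>,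
        overwriting that row by \<open>u\<close> changes no answer, so the strategy still outputs
        \<open>u\<close> and loses.\<close>
      have "v(i := u) \<in> vector_lists n m"
        using v u i by (auto simp: vector_lists_def PiE_def extensional_def)
      moreover have "\<forall>(i', j)\<in>Q. (v(i := u)) i' j = f i' j"
      proof clarify
        fix i' j assume "(i', j) \<in> Q"
        moreover from this have "j \<in> {1..n}" using Q by blast
        ultimately show "(v(i := u)) i' j = f i' j"
          using vf no by (cases "i' = i") (auto simp: B_def)
      qed
      ultimately show False
        using f win i by (metis fun_upd_same)
    qed
  qed
  then have "card {1..m} \<le> card (\<Union>j\<in>{1..n}. B j)"
    using fin by (intro card_mono) auto
  also have "\<dots> \<le> (\<Sum>j\<in>{1..n}. card (B j))"
    by (rule card_UN_le) simp
  finally have m: "m \<le> (\<Sum>j\<in>{1..n}. card (B j))" by simp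
  have "Q = (\<lambda>(j, i). (i, j)) ` (SIGMA j:{1..n}. B j \<union> G j)"
    using Q by (force simp: B_def G_def image_iff)
  then have "card Q = card (SIGMA j:{1..n}. B j \<union> G j)"
    using card_image[of "\<lambda>(j, i). (i, j)" "SIGMA j:{1..n}. B j \<union> G j"]
    by (auto simp: inj_on_def)
  also have "\<dots> = (\<Sum>j\<in>{1..n}. card (B j) + card (G j))"
  proof -
    have "card (B j \<union> G j) = card (B j) + card (G j)" for j
      using fin by (intro card_Un_disjoint) (auto simp: B_def G_def)
    then show ?thesis using fin by simp
  qed
  finally have Q_sum: "card Q = (\<Sum>j\<in>{1..n}. card (B j)) + (\<Sum>j\<in>{1..n}. card (G j))"
    by (simp add: sum.distrib)
  show "m \<le> q" using m Q_sum cardQ by linarith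
  have "card (B j) \<le> card (G j) + 1" for j
  proof -
    have "B j = {i. (i, j) \<in> Q \<and> f i j = (\<not> u j)}" "G j = {i. (i, j) \<in> Q \<and> f i j \<noteq> (\<not> u j)}"
      by (auto simp: B_def G_def)
    then show ?thesis
      using bal[unfolded balanced_def, THEN spec[of _ j], THEN spec[of _ "\<not> u j"]] by simp
  qed
  then have "(\<Sum>j\<in>{1..n}. card (B j)) \<le> (\<Sum>j\<in>{1..n}. card (G j) + 1)"
    by (rule sum_mono)
  then have "(\<Sum>j\<in>{1..n}. card (B j)) \<le> (\<Sum>j\<in>{1..n}. card (G j)) + n"
    by (simp add: sum_Suc)
  \<comment> \<open>Write b and g for the sums of \<open>card (B j)\<close> and
    \<open>card (G j)\<close>. Then 2m \<le> 2b \<le> b + g + n = |Q| + n \<le> q + n.\<close>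
  then show "2 * m \<le> q + n" using m Q_sum cardQ by linarith
qed

theorem theorem3p1:
  fixes m n :: nat
  assumes "0 < m" and "0 < n" and "m < 2 ^ n"
  shows "g n m = (if m \<le> n then m else 2 * m - n)"
  unfolding g_def
proof (rule Least_equality)
  show "\<exists>s. wins_within n m (if m \<le> n then m else 2 * m - n) s"
    using assms(3) by (rule wins_within_upper)
next
  fix q assume "\<exists>s. wins_within n m q s"
  then have "m \<le> q" "2 * m \<le> q + n"
    using wins_within_lower by blast+
  then show "(if m \<le> n then m else 2 * m - n) \<le> q"
    by auto
qed

end
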